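(* Let $q$ be a prime power and $m,l,k$ integers with $3\le k\le\min\{m+1,l\}$. Then there is a disjoint decomposition $$\Omega_k^{k-1}=\bigsqcup_{r=1}^{k-1}\Omega_{k,r}^{k-1}=\bigsqcup_{r=1}^{k-1}\ \bigsqcup_{T\in\mathcal F_{k,r}^{k-1}}T^G .$$
   Context: $V$ is an $m$-dimensional vector space over $\mathrm{GF}(q^l)$ with basis $Y_1,\dots,Y_m$, regarded also as an $ml$-dimensional space over $\mathrm{GF}(q)$. $G=\mathrm{GL}(m,q^l)$ acts $\mathrm{GF}(q^l)$-linearly on $V$ and hence on the $\mathrm{GF}(q)$-subspaces of $V$; $W^G=\{g(W):g\in G\}$ is the $G$-orbit of $W$. $\langle\cdot\rangle$ denotes $\mathrm{GF}(q)$-span and $\langle\cdot\rangle_{\mathrm{GF}(q^l)}$ denotes $\mathrm{GF}(q^l)$-span. $\Omega_i^j$ is the set of $\mathrm{GF}(q)$-subspaces $W\le V$ with $\dim_{\mathrm{GF}(q)}W=i$ and $\dim_{\mathrm{GF}(q^l)}\langle W\rangle_{\mathrm{GF}(q^l)}=j$. For $1\le r\le k-1$ and $u_1,\dots,u_r\in\mathrm{GF}(q^l)$ with $1,u_1,\dots,u_r$ linearly independent over $\mathrm{GF}(q)$, put $$T(u_1,\dots,u_r)=\langle Y_1,\dots,Y_{k-1},\,u_1Y_1+\cdots+u_rY_r\rangle\in\Omega_k^{k-1}.$$ $\Omega_{k,r}^{k-1}$ is the union of all $G$-orbits $T(u_1,\dots,u_r)^G$ over all such $u_1,\dots,u_r$,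 and $\mathcal F_{k,r}^{k-1}$ is a complete set of representatives of the $G$-orbits on $\Omega_{k,r}^{k-1}$. *)

theory Defs
  imports Complex_Main "HOL-Library.Cardinality" "HOL-Library.Disjoint_Sets" "HOL-Number_Theory.Prime_Powers"
begin

text \<open>
  The field extension is modelled by a field homomorphism \<open>emb\<close> between two field types, the
  large field \<open>'a\<close> being an extension of the image of \<open>'k\<close>. Restricting scalars along \<open>emb\<close>
  turns every vector space over \<open>'a\<close> (and, with the multiplication as scaling, \<open>'a\<close> itself) into
  a vector space over \<open>'k\<close>, so that the notions of \<^theory>\<open>HOL.Vector_Spaces\<close> apply over both fields.
\<close>

definition field_embedding :: "('k::field \<Rightarrow> 'a::field) \<Rightarrow> bool" where
  "field_embedding emb \<longleftrightarrow>
     emb 1 = 1 \<and> (\<forall>x y. emb (x + y) = emb x + emb y) \<and> (\<forall>x y. emb (x * y) = emb x * emb y)"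

definition restrict_scalars ::
    "('k \<Rightarrow> 'a) \<Rightarrow> ('a \<Rightarrow> 'v \<Rightarrow> 'v) \<Rightarrow> 'k \<Rightarrow> 'v \<Rightarrow> 'v" where
  "restrict_scalars emb scale = (\<lambda>c. scale (emb c))"

definition is_basis_family ::
    "('a::field \<Rightarrow> 'v::ab_group_add \<Rightarrow> 'v) \<Rightarrow> nat \<Rightarrow> (nat \<Rightarrow> 'v) \<Rightarrow> bool" where
  "is_basis_family scale m Y \<longleftrightarrow>
     inj_on Y {1..m} \<and> \<not> module.dependent scale (Y ` {1..m}) \<and>
     module.span scale (Y ` {1..m}) = UNIV"

definition GL :: "('a::field \<Rightarrow> 'v::ab_group_add \<Rightarrow> 'v) \<Rightarrow> ('v \<Rightarrow> 'v) set" where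
  "GL scale = {g. Vector_Spaces.linear scale scale g \<and> bij g}"

definition GL_orbit ::
    "('a::field \<Rightarrow> 'v::ab_group_add \<Rightarrow> 'v) \<Rightarrow> 'v set \<Rightarrow> 'v set set" where
  "GL_orbit scale W = {g ` W | g. g \<in> GL scale}"

definition Omega ::
    "('k::field \<Rightarrow> 'a::field) \<Rightarrow> ('a \<Rightarrow> 'v::ab_group_add \<Rightarrow> 'v) \<Rightarrow> nat \<Rightarrow> nat \<Rightarrow> 'v set set" where
  "Omega emb scale i j =
     {W. module.subspace (restrict_scalars emb scale) W \<and>
         vector_space.dim (restrict_scalars emb scale) W = i \<and>
         vector_space.dim scale (module.span scale W) = j}"

text \<open>
  Linear independence over \<open>'k\<close> of the family \<open>1, u 1, \<dots>, u r\<close>; the library's notion is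
  about sets, so the members of the family are also required to be distinct.
\<close>

definition indep_with_one :: "('k::field \<Rightarrow> 'a::field) \<Rightarrow> nat \<Rightarrow> (nat \<Rightarrow> 'a) \<Rightarrow> bool" where
  "indep_with_one emb r u \<longleftrightarrow>
     inj_on u {1..r} \<and> 1 \<notin> u ` {1..r} \<and>
     \<not> module.dependent (restrict_scalars emb (*)) (insert 1 (u ` {1..r}))"

definition T_space ::
    "('k::field \<Rightarrow> 'a::field) \<Rightarrow> ('a \<Rightarrow> 'v::ab_group_add \<Rightarrow> 'v) \<Rightarrow> (nat \<Rightarrow> 'v) \<Rightarrow>
     nat \<Rightarrow> nat \<Rightarrow> (nat \<Rightarrow> 'a) \<Rightarrow> 'v set" where
  "T_space emb scale Y k r u =
     module.span (restrict_scalars emb scale)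
       (insert (\<Sum>i=1..r. scale (u i) (Y i)) (Y ` {1..k-1}))"

definition Omega_r ::
    "('k::field \<Rightarrow> 'a::field) \<Rightarrow> ('a \<Rightarrow> 'v::ab_group_add \<Rightarrow> 'v) \<Rightarrow> (nat \<Rightarrow> 'v) \<Rightarrow>
     nat \<Rightarrow> nat \<Rightarrow> 'v set set" where
  "Omega_r emb scale Y k r =
     (\<Union>u \<in> {u. indep_with_one emb r u}. GL_orbit scale (T_space emb scale Y k r u))"

definition complete_orbit_reps ::
    "('a::field \<Rightarrow> 'v::ab_group_add \<Rightarrow> 'v) \<Rightarrow> 'v set set \<Rightarrow> 'v set set \<Rightarrow> bool" where
  "complete_orbit_reps scale X F \<longleftrightarrow>
     F \<subseteq> X \<and> (\<forall>A \<in> GL_orbit scale ` X. \<exists>!T. T \<in> F \<and> T \<in> A)"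

end

theory Submission
  imports Defs
begin

text \<open>
  Write \<open>K\<close> and \<open>L\<close> for the small and the large field. A space \<open>W\<close> in \<open>\<Omega>\<^sub>k\<^sup>k\<^sup>-\<^sup>1\<close> is the \<open>K\<close>-span of
  \<open>k - 1\<close> vectors \<open>e i\<close> independent over \<open>L\<close> and one more vector \<open>w = \<Sum>i. a i *s e i\<close>. Choose
  \<open>1, u 1, \<dots>, u r\<close> as a \<open>K\<close>-basis of the span of \<open>1\<close> and the \<open>a i\<close>, with the \<open>u i\<close> among the \<open>a i\<close>;
  expanding the remaining coefficients in this basis and regrouping replaces the \<open>e i\<close> by another
  basis of the same \<open>K\<close>-space for which \<open>w\<close>, up to a vector of that space, has the coefficients
  \<open>u 1, \<dots>, u r, 0, \<dots>, 0\<close>. Thus \<open>W\<close> is the image of \<open>T(u 1, \<dots>, u r)\<close> under an \<open>L\<close>-linear bijection.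
  Conversely \<open>r\<close> is an invariant of the orbit: \<open>r + 1\<close> is the least number \<open>n\<close> for which there is a
  relation \<open>\<Sum>j=1..n. b j *s x j = 0\<close> with the \<open>b j\<close> in \<open>L\<close> independent over \<open>K\<close> and the \<open>x j\<close> in \<open>W\<close>
  not all zero.
\<close>

section \<open>Independence of indexed families, dimension, and orbits over a single field\<close>

context vector_space
begin

text \<open>\<open>independent\<close> is a property of sets, while bases and coefficients are
  indexed here. This lemma and the next pass between the set notion together with injectivity and
  the vanishing of indexed coefficients.\<close>

lemma independent_familyD:
  assumes "finite I" "inj_on f I" "independent (f ` I)"
    and "(\<Sum>i\<in>I. c i *s f i) = 0" "i \<in> I"
  shows "c i = 0"
proof -
  have "(\<Sum>v\<in>f ` I. c (inv_into I f v) *s v) = (\<Sum>i\<in>I. c i *s f i)"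
    using assms(2) by (subst sum.reindex) (auto intro!: sum.cong)
  then have "c (inv_into I f (f i)) = 0"
    using independentD[OF assms(3) _ subset_refl, of "\<lambda>v. c (inv_into I f v)" "f i"] assms by simp
  then show ?thesis using assms by simp
qed

lemma independent_familyI:
  assumes "finite I"
    and zero: "\<And>c i. (\<Sum>i\<in>I. c i *s f i) = 0 \<Longrightarrow> i \<in> I \<Longrightarrow> c i = 0"
  shows "inj_on f I" and "independent (f ` I)"
proof -
  show inj: "inj_on f I"
  proof (rule inj_onI, rule ccontr)
    fix i j assume ij: "i \<in> I" "j \<in> I" "f i = f j" "i \<noteq> j"
    \<comment> \<open>A repeated vector gives a nontrivial relation with coefficients 1 and
      -1.\<close>
    define c where "c = (\<lambda>l. if l = i then 1 else if l = j then - 1 else (0::'a))"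
    have "(\<Sum>l\<in>I. c l *s f l) = (\<Sum>l\<in>{i, j}. c l *s f l)"
      using assms(1) ij by (intro sum.mono_neutral_right) (auto simp: c_def)
    also have "\<dots> = 0" using ij by (simp add: c_def)
    finally have "c i = 0" using zero ij by blast
    then show False by (simp add: c_def)
  qed
  show "independent (f ` I)"
  proof (rule independent_if_scalars_zero)
    fix g x assume "(\<Sum>x\<in>f ` I. g x *s x) = 0" "x \<in> f ` I"
    then show "g x = 0"
      using zero[of "\<lambda>i. g (f i)"] by (auto simp: sum.reindex[OF inj])
  qed (use assms in simp)
qed

lemma span_familyE:
  assumes "finite I" "inj_on f I" "x \<in> span (f ` I)"
  obtains c where "x = (\<Sum>i\<in>I. c i *s f i)"
proof -
  obtain d where "x = (\<Sum>v\<in>f ` I. d v *s v)"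
    using assms span_finite[of "f ` I"] by auto
  then show ?thesis using that[of "\<lambda>i. d (f i)"] by (simp add: sum.reindex[OF assms(2)])
qed

lemma span_insert_familyE:
  assumes "finite I" "inj_on f I" "x \<in> span (insert w (f ` I))"
  obtains d c where "x = d *s w + (\<Sum>i\<in>I. c i *s f i)"
proof -
  obtain d where "x - d *s w \<in> span (f ` I)"
    using assms(3) by (auto simp: span_breakdown_eq)
  then obtain c where "x - d *s w = (\<Sum>i\<in>I. c i *s f i)"
    using assms span_familyE by metis
  then have "x = d *s w + (\<Sum>i\<in>I. c i *s f i)" by (simp add: algebra_simps)
  then show ?thesis by (rule that)
qed

lemma dim_injective_image:
  assumes "module_hom scale scale g" "inj g"
  shows "dim (g ` W) = dim W"
proof -
  interpret g: module_hom scale scale g by fact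
  obtain B where B: "B \<subseteq> W" "independent B" "W \<subseteq> span B" "card B = dim W"
    by (rule basis_exists)
  show ?thesis
  proof (rule dim_unique)
    show "g ` B \<subseteq> g ` W" using B by blast
    show "g ` W \<subseteq> span (g ` B)" using B by (auto simp: g.span_image)
    show "independent (g ` B)"
      by (rule g.independent_injective_image[OF B(2)]) (rule inj_on_subset[OF assms(2)], simp)
    show "card (g ` B) = dim W"
      using B assms(2) by (metis card_image inj_on_subset subset_UNIV)
  qed
qed

section \<open>Group laws for \<open>GL\<close>, its orbits, and orbit representatives\<close>

lemma GL_id: "id \<in> GL scale"
  by (simp add: GL_def linear_id)

lemma GL_comp: "g \<in> GL scale \<Longrightarrow> h \<in> GL scale \<Longrightarrow> g \<circ> h \<in> GL scale"
  by (auto simp: GL_def bij_comp Vector_Spaces.linear_compose)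

lemma GL_inv: "g \<in> GL scale \<Longrightarrow> inv g \<in> GL scale"
  using module_pair.bij_module_hom_imp_inv_module_hom[of scale scale scale scale g] module_axioms
  by (auto simp: GL_def bij_imp_bij_inv module_pair_def module_hom_eq_linear)

lemma GL_orbit_refl: "W \<in> GL_orbit scale W"
proof -
  have "W = id ` W" by simp
  then show ?thesis unfolding GL_orbit_def using GL_id by blast
qed

lemma GL_orbit_sym: assumes "W \<in> GL_orbit scale W'" shows "W' \<in> GL_orbit scale W"
proof -
  obtain g where g: "g \<in> GL scale" "W = g ` W'" using assms by (auto simp: GL_orbit_def)
  then have "W' = inv g ` W" by (simp add: GL_def image_inv_f_f bij_is_inj)
  then show ?thesis using GL_inv[OF g(1)] by (auto simp: GL_orbit_def)
qed

lemma GL_orbit_trans: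
  assumes "W \<in> GL_orbit scale W'" "W' \<in> GL_orbit scale W''" shows "W \<in> GL_orbit scale W''"
proof -
  obtain g h where "g \<in> GL scale" "h \<in> GL scale" and W: "W = g ` W'" "W' = h ` W''"
    using assms by (auto simp: GL_orbit_def)
  then have "g \<circ> h \<in> GL scale" by (intro GL_comp)
  moreover have "W = (g \<circ> h) ` W''" by (simp add: W image_comp)
  ultimately show ?thesis unfolding GL_orbit_def by blast
qed

lemma complete_orbit_reps_ex1:
  "complete_orbit_reps scale X F \<Longrightarrow> W \<in> X \<Longrightarrow> \<exists>!T. T \<in> F \<and> T \<in> GL_orbit scale W"
  by (simp add: complete_orbit_reps_def)

lemma complete_orbit_reps_subset: "complete_orbit_reps scale X F \<Longrightarrow> F \<subseteq> X"
  by (simp add: complete_orbit_reps_def)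

text \<open>By symmetry of the orbit relation, each \<open>W\<close> lies in the orbit of its
  representative. Conversely, \<open>closed\<close> keeps the orbit of a representative inside
  \<open>X\<close>.\<close>

lemma complete_orbit_reps_Union:
  assumes F: "complete_orbit_reps scale X F"
    and closed: "\<And>W W'. W \<in> X \<Longrightarrow> W' \<in> GL_orbit scale W \<Longrightarrow> W' \<in> X"
  shows "X = (\<Union>T\<in>F. GL_orbit scale T)"
proof (intro subset_antisym subsetI)
  fix W assume "W \<in> X"
  then obtain T where T: "T \<in> F" "T \<in> GL_orbit scale W"
    using complete_orbit_reps_ex1[OF F] by blast
  then show "W \<in> (\<Union>T\<in>F. GL_orbit scale T)" using GL_orbit_sym by blast
next
  fix W assume "W \<in> (\<Union>T\<in>F. GL_orbit scale T)"
  then obtain T where T: "T \<in> F" "W \<in> GL_orbit scale T" by blast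
  then show "W \<in> X" using closed[of T W] complete_orbit_reps_subset[OF F] by blast
qed

text \<open>Both \<open>T\<close> and \<open>T'\<close> lie in the orbit of \<open>T\<close>, which
  contains only one representative.\<close>

lemma complete_orbit_reps_unique:
  assumes F: "complete_orbit_reps scale X F" and T: "T \<in> F" "T' \<in> F"
    and W: "W \<in> GL_orbit scale T" "W \<in> GL_orbit scale T'"
  shows "T = T'"
proof -
  have "T' \<in> GL_orbit scale T"
    by (rule GL_orbit_trans[OF GL_orbit_sym[OF W(2)] W(1)])
  moreover have "\<exists>!S. S \<in> F \<and> S \<in> GL_orbit scale T"
    by (rule complete_orbit_reps_ex1[OF F subsetD[OF complete_orbit_reps_subset[OF F] T(1)]])
  ultimately show ?thesis using T GL_orbit_refl[of T] by blast
qed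

end

section \<open>Restriction of scalars along the field embedding\<close>

locale scalar_extension = vector_space scale
  for scale :: "'a::field \<Rightarrow> 'v::ab_group_add \<Rightarrow> 'v" (infixr \<open>*s\<close> 75) +
  fixes emb :: "'k::field \<Rightarrow> 'a"
  assumes embedding: "field_embedding emb"
begin

lemma emb_1: "emb 1 = 1" and emb_add: "emb (x + y) = emb x + emb y"
  and emb_mult: "emb (x * y) = emb x * emb y"
  using embedding by (auto simp: field_embedding_def)

lemma emb_0: "emb 0 = 0"
  using emb_add[of 0 0] by (metis add_cancel_right_right)

lemma emb_eq_0_iff: "emb x = 0 \<longleftrightarrow> x = 0"
proof (cases "x = 0")
  case False
  then have "emb x * emb (inverse x) = 1" by (simp flip: emb_mult add: emb_1)
  with False show ?thesis by auto
qed (simp add: emb_0)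

sublocale K: vector_space "restrict_scalars emb scale"
  by unfold_locales
    (simp_all add: restrict_scalars_def emb_1 emb_add emb_mult scale_left_distrib scale_right_distrib)

text \<open>\<open>L\<close> itself as a \<open>K\<close>-space: the home of the coefficients
  \<open>u i\<close> and of their independence from 1.\<close>

sublocale KL: vector_space "restrict_scalars emb (*)"
  by unfold_locales
    (simp_all add: restrict_scalars_def emb_1 emb_add emb_mult algebra_simps)

lemma K_scale: "restrict_scalars emb scale c x = emb c *s x"
  and KL_scale: "restrict_scalars emb (*) c b = emb c * b"
  by (simp_all add: restrict_scalars_def)

lemma K_span_subset_span: "K.span X \<subseteq> span X"
  by (rule K.span_minimal[OF span_superset], rule K.subspaceI)
    (auto simp: K_scale span_zero span_add span_scale)

text \<open>Lets the \<open>L\<close>-dimension in \<open>Omega\<close> be read off from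
  \<open>K\<close>-generators.\<close>

lemma span_K_span: "span (K.span X) = span X"
  by (meson K.span_superset K_span_subset_span span_minimal span_mono subspace_span subset_antisym)

lemma K_linear_if_linear:
  assumes "Vector_Spaces.linear scale scale g"
  shows "module_hom (restrict_scalars emb scale) (restrict_scalars emb scale) g"
  using assms K.module_axioms
  by (simp add: module_hom_iff K_scale linear_iff_module_hom)

lemma Omega_GL_image:
  assumes "W \<in> Omega emb scale i j" "g \<in> GL scale"
  shows "g ` W \<in> Omega emb scale i j"
proof -
  interpret g: Vector_Spaces.linear scale scale g using assms(2) by (simp add: GL_def)
  interpret gK: module_hom "restrict_scalars emb scale" "restrict_scalars emb scale" g
    by (rule K_linear_if_linear) (rule g.linear_axioms)
  have inj: "inj g" using assms(2) by (simp add: GL_def bij_is_inj)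
  have "K.dim (g ` W) = K.dim W"
    by (rule K.dim_injective_image) (rule gK.module_hom_axioms, rule inj)
  moreover have "dim (g ` W) = dim W"
    by (rule dim_injective_image) (rule g.module_hom_axioms, rule inj)
  moreover have "K.subspace (g ` W)"
    using assms(1) by (intro gK.subspace_image) (simp add: Omega_def)
  ultimately show ?thesis using assms(1) by (simp add: Omega_def)
qed

section \<open>The spaces \<open>T_space\<close>: membership in \<open>Omega\<close>, and
  \<open>r\<close> as an orbit invariant\<close>

lemma T_space_image:
  assumes "g \<in> GL scale"
  shows "g ` T_space emb scale Y k r u = T_space emb scale (\<lambda>i. g (Y i)) k r u"
proof -
  interpret g: Vector_Spaces.linear scale scale g using assms by (simp add: GL_def)
  interpret gK: module_hom "restrict_scalars emb scale" "restrict_scalars emb scale" g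
    by (rule K_linear_if_linear) (rule g.linear_axioms)
  show ?thesis
    by (simp add: T_space_def image_image g.sum g.scale flip: gK.span_image)
qed

text \<open>The extra generator lies in the \<open>L\<close>-span of the \<open>Y i\<close>, so the
  \<open>L\<close>-dimension is \<open>k - 1\<close>. It is outside their \<open>K\<close>-span,
  because its coefficient \<open>u 1\<close> at \<open>Y 1\<close> would otherwise be a
  \<open>K\<close>-multiple of 1; this raises the \<open>K\<close>-dimension to
  \<open>k\<close>.\<close>

lemma T_space_in_Omega:
  assumes inj: "inj_on Y {1..k-1}" and ind: "independent (Y ` {1..k-1})"
    and r: "1 \<le> r" "r \<le> k - 1" and u: "indep_with_one emb r u"
  shows "T_space emb scale Y k r u \<in> Omega emb scale k (k - 1)"
proof -
  define v where "v = (\<Sum>i=1..r. u i *s Y i)"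
  have v_span: "v \<in> span (Y ` {1..k-1})"
    unfolding v_def using r by (intro span_sum span_scale span_base) auto
  have coeff_in_K: False if eq: "v = (\<Sum>i=1..k-1. restrict_scalars emb scale (c i) (Y i))" for c
  proof -
    have "(\<Sum>i=1..k-1. ((if i \<le> r then u i else 0) - emb (c i)) *s Y i)
        = (\<Sum>i=1..k-1. (if i \<le> r then u i else 0) *s Y i) - (\<Sum>i=1..k-1. emb (c i) *s Y i)"
      by (simp add: scale_left_diff_distrib sum_subtractf)
    also have "(\<Sum>i=1..k-1. (if i \<le> r then u i else 0) *s Y i) = v"
      unfolding v_def using r by (intro sum.mono_neutral_cong_right) auto
    finally have "(if 1 \<le> r then u 1 else 0) - emb (c 1) = 0"
      using independent_familyD[OF _ inj ind, of "\<lambda>i. (if i \<le> r then u i else 0) - emb (c i)" 1] eq r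
      by (simp add: K_scale)
    then have "u 1 = restrict_scalars emb (*) (c 1) 1"
      using r by (simp add: KL_scale)
    then have "u 1 \<in> KL.span {1}"
      by (metis KL.span_base KL.span_scale singletonI)
    moreover have "u 1 \<noteq> 1" using u r by (force simp: indep_with_one_def)
    moreover have "KL.independent (insert (u 1) {1})"
      by (rule KL.independent_mono[of "insert 1 (u ` {1..r})"]) (use u r in \<open>auto simp: indep_with_one_def\<close>)
    ultimately show False by (simp add: KL.independent_insert)
  qed
  have indK: "K.independent (Y ` {1..k-1})"
  proof (rule K.independent_familyI)
    fix c i assume "(\<Sum>i=1..k-1. restrict_scalars emb scale (c i) (Y i)) = 0" "i \<in> {1..k-1}"
    then show "c i = 0"
      using independent_familyD[OF _ inj ind, of "\<lambda>i. emb (c i)" i]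
      by (simp add: K_scale emb_eq_0_iff)
  qed simp
  have notin: "v \<notin> K.span (Y ` {1..k-1})"
    using coeff_in_K K.span_familyE[OF _ inj] by (metis finite_atLeastAtMost)
  have T: "T_space emb scale Y k r u = K.span (insert v (Y ` {1..k-1}))"
    by (simp add: T_space_def v_def)
  have "card (insert v (Y ` {1..k-1})) = k"
  proof -
    have "v \<notin> Y ` {1..k-1}" using notin K.span_base by blast
    then have "card (insert v (Y ` {1..k-1})) = Suc (card (Y ` {1..k-1}))" by simp
    also have "\<dots> = k" using r by (simp only: card_image[OF inj] card_atLeastAtMost)
    finally show ?thesis .
  qed
  then have "K.dim (T_space emb scale Y k r u) = k"
    unfolding T using K.dim_span_eq_card_independent[OF K.independent_insertI[OF notin indK]] by simp
  moreover have "dim (span (T_space emb scale Y k r u)) = k - 1"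
    unfolding T span_K_span span_redundant[OF v_span] dim_span_eq_card_independent[OF ind]
    by (simp only: card_image[OF inj] card_atLeastAtMost)
  ultimately show ?thesis by (simp add: Omega_def T)
qed

text \<open>The relation says that \<open>\<Sum>t\<in>S. t \<otimes> x t\<close> lies in the kernel of the multiplication map
  from \<open>L \<otimes>\<^sub>K T\<close> to \<open>V\<close>: every nonzero element of this kernel has tensor rank at least \<open>r + 1\<close>.\<close>

lemma T_space_relation_rank:
  assumes inj: "inj_on Y {1..k-1}" and ind: "independent (Y ` {1..k-1})"
    and r: "r \<le> k - 1" and u: "indep_with_one emb r u"
    and S: "finite S" "KL.independent S"
    and x: "\<And>t. t \<in> S \<Longrightarrow> x t \<in> T_space emb scale Y k r u"
    and rel: "(\<Sum>t\<in>S. t *s x t) = 0" and t0: "t0 \<in> S" "x t0 \<noteq> 0"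
  shows "r + 1 \<le> card S"
proof -
  define v where "v = (\<Sum>i=1..r. u i *s Y i)"
  define u' where "u' i = (if i \<le> r then u i else 0)" for i
  have v: "v = (\<Sum>i=1..k-1. u' i *s Y i)"
    unfolding v_def u'_def using r by (intro sum.mono_neutral_cong_left) auto
  have "\<forall>t\<in>S. \<exists>d c. x t = emb d *s v + (\<Sum>i=1..k-1. emb (c i) *s Y i)"
  proof
    fix t assume "t \<in> S"
    then have "x t \<in> K.span (insert v (Y ` {1..k-1}))"
      using x by (simp add: T_space_def v_def)
    then obtain d c where "x t = restrict_scalars emb scale d v
        + (\<Sum>i=1..k-1. restrict_scalars emb scale (c i) (Y i))"
      by (rule K.span_insert_familyE[OF finite_atLeastAtMost inj])
    then show "\<exists>d c. x t = emb d *s v + (\<Sum>i=1..k-1. emb (c i) *s Y i)"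
      unfolding K_scale by blast
  qed
  then obtain d c where xt: "\<And>t. t \<in> S \<Longrightarrow> x t = emb (d t) *s v + (\<Sum>i=1..k-1. emb (c t i) *s Y i)"
    by metis
  \<comment> \<open>\<open>D\<close> and the \<open>C i\<close> are the total coefficients of
    \<open>v\<close> and of the \<open>Y i\<close> once every \<open>x t\<close> in the relation is
    expanded over \<open>K\<close>.\<close>
  define D where "D = (\<Sum>t\<in>S. t * emb (d t))"
  define C where "C i = (\<Sum>t\<in>S. t * emb (c t i))" for i
  have "(\<Sum>t\<in>S. t *s x t) = (\<Sum>t\<in>S. (t * emb (d t)) *s v + (\<Sum>i=1..k-1. (t * emb (c t i)) *s Y i))"
    by (simp add: xt scale_right_distrib scale_sum_right)
  also have "\<dots> = D *s v + (\<Sum>i=1..k-1. C i *s Y i)"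
    unfolding D_def C_def scale_sum_left sum.distrib by (subst sum.swap) (rule refl)
  also have "\<dots> = (\<Sum>i=1..k-1. (D * u' i + C i) *s Y i)"
    by (simp add: v scale_sum_right scale_left_distrib sum.distrib)
  finally have coeff: "D * u' i + C i = 0" if "i \<in> {1..k-1}" for i
    using independent_familyD[OF _ inj ind, of "\<lambda>i. D * u' i + C i" i] that rel by simp
  have KL_zero: "f t = 0" if "(\<Sum>t\<in>S. t * emb (f t)) = 0" "t \<in> S" for f t
    using KL.independentD[OF S(2) S(1) subset_refl, of f t] that by (simp add: KL_scale mult.commute)
  \<comment> \<open>If \<open>D\<close> vanished, \<open>coeff\<close> would make every
    \<open>C i\<close> vanish too, and independence of \<open>S\<close> would then kill all
    \<open>K\<close>-coefficients of \<open>x t0\<close>.\<close>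
  have D: "D \<noteq> 0"
  proof
    assume "D = 0"
    then have "d t0 = 0" "c t0 i = 0" if "i \<in> {1..k-1}" for i
      using coeff[OF that] KL_zero[of d t0] KL_zero[of "\<lambda>t. c t i" t0] t0
      by (auto simp: D_def C_def)
    moreover have "d t0 = 0" using \<open>D = 0\<close> KL_zero t0 by (auto simp: D_def)
    ultimately show False using xt[OF t0(1)] t0 by (simp add: emb_0)
  qed
  \<comment> \<open>The count to come: multiplication by \<open>D\<close> sends
    \<open>1, u 1, ..., u r\<close> to \<open>r + 1\<close> independent elements of the
    \<open>K\<close>-span of \<open>S\<close>.\<close>
  have in_span: "(\<Sum>t\<in>S. t * emb (f t)) \<in> KL.span S" for f
    using KL.span_sum[of S "\<lambda>t. restrict_scalars emb (*) (f t) t" S]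
    by (simp add: KL.span_scale KL.span_base) (simp add: KL_scale mult.commute)
  have "D \<in> KL.span S" using in_span by (simp add: D_def)
  moreover have "D * u i \<in> KL.span S" if "i \<in> {1..r}" for i
  proof -
    have "D * u i = - C i" using coeff[of i] that r by (simp add: u'_def eq_neg_iff_add_eq_0)
    then show ?thesis using in_span by (simp add: C_def KL.span_neg)
  qed
  ultimately have "(*) D ` insert 1 (u ` {1..r}) \<subseteq> KL.span S" by auto
  moreover have "KL.independent ((*) D ` insert 1 (u ` {1..r}))"
  proof -
    interpret D: module_hom "restrict_scalars emb (*)" "restrict_scalars emb (*)" "(*) D"
      using KL.module_axioms by (simp add: module_hom_iff KL_scale algebra_simps)
    show ?thesis
      using u D by (intro D.independent_injective_image) (auto simp: indep_with_one_def inj_on_def)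
  qed
  ultimately have "card ((*) D ` insert 1 (u ` {1..r})) \<le> card S"
    using KL.independent_span_bound[OF S(1)] by blast
  moreover have "card ((*) D ` insert 1 (u ` {1..r})) = r + 1"
  proof -
    have "inj_on ((*) D) X" for X using D by (simp add: inj_on_def)
    then have "card ((*) D ` insert 1 (u ` {1..r})) = card (insert 1 (u ` {1..r}))"
      by (rule card_image)
    also have "\<dots> = r + 1"
      using u unfolding indep_with_one_def by (simp add: card_image del: One_nat_def)
    finally show ?thesis .
  qed
  ultimately show ?thesis by simp
qed

text \<open>The definition of the last generator \<open>v\<close> of the source space is a relation
  with the \<open>r' + 1\<close> independent coefficients \<open>1, u' 1, ..., u' r'\<close>. Its
  image under \<open>g\<close> is a relation in the target space, to which
  \<open>T_space_relation_rank\<close> applies.\<close>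

lemma T_space_image_rank_le:
  assumes inj: "inj_on Y {1..k-1}" and ind: "independent (Y ` {1..k-1})"
    and r: "r \<le> k - 1" "r' \<le> k - 1" "1 \<le> r'"
    and u: "indep_with_one emb r u" "indep_with_one emb r' u'"
    and g: "g \<in> GL scale" "g ` T_space emb scale Y k r' u' \<subseteq> T_space emb scale Y k r u"
  shows "r \<le> r'"
proof -
  interpret g: Vector_Spaces.linear scale scale g using g(1) by (simp add: GL_def)
  let ?S = "insert 1 (u' ` {1..r'})"
  define v where "v = (\<Sum>i=1..r'. u' i *s Y i)"
  \<comment> \<open>The relation is indexed by its coefficients: 1 is paired with
    \<open>- g v\<close>, and \<open>u' i\<close> with \<open>g (Y i)\<close>.\<close>
  define x where "x t = (if t = 1 then - g v else g (Y (inv_into {1..r'} u' t)))" for t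
  have inj': "inj_on u' {1..r'}" and notin: "1 \<notin> u' ` {1..r'}" and indS: "KL.independent ?S"
    using u(2) by (auto simp: indep_with_one_def)
  have xu: "x (u' i) = g (Y i)" if "i \<in> {1..r'}" for i
    using notin that inj' by (auto simp: x_def)
  have "r + 1 \<le> card ?S"
  proof (rule T_space_relation_rank[OF inj ind r(1) u(1) _ indS])
    show "(\<Sum>t\<in>?S. t *s x t) = 0"
      using notin by (simp add: sum.reindex[OF inj'] xu del: One_nat_def) (simp add: x_def v_def g.sum g.scale)
    have inT: "T_space emb scale Y k r u = K.span (T_space emb scale Y k r u)"
      by (simp add: T_space_def K.span_span)
    have "v \<in> T_space emb scale Y k r' u'"
      unfolding T_space_def v_def by (intro K.span_base) simp
    then have "g v \<in> T_space emb scale Y k r u" using g(2) by blast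
    then have "- g v \<in> T_space emb scale Y k r u"
      by (subst inT, intro K.span_neg K.span_base)
    moreover have "g (Y i) \<in> T_space emb scale Y k r u" if "i \<in> {1..r'}" for i
    proof -
      have "Y i \<in> T_space emb scale Y k r' u'"
        unfolding T_space_def using that r by (intro K.span_base) auto
      then show ?thesis using g(2) by blast
    qed
    ultimately show "x t \<in> T_space emb scale Y k r u" if "t \<in> ?S" for t
      using that xu by (auto simp: x_def[of 1])
    \<comment> \<open>The nonzero term required of the relation is \<open>g (Y 1)\<close>; it occurs
      because \<open>1 \<le> r'\<close>.\<close>
    show "u' 1 \<in> ?S" using r by auto
    have "Y 1 \<noteq> 0" using ind r dependent_zero[of "Y ` {1..k-1}"] by force
    moreover have "inj g" using g(1) by (simp add: GL_def bij_is_inj)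
    ultimately have "g (Y 1) \<noteq> 0" by (metis g.zero injD)
    then show "x (u' 1) \<noteq> 0" using xu r by simp
  qed simp
  then show ?thesis using notin by (simp add: card_image[OF inj'] del: One_nat_def)
qed


section \<open>Normal form of a space in \<open>Omega emb scale k (k - 1)\<close>\<close>

lemma Omega_imp_T_space:
  assumes W: "W \<in> Omega emb scale k (k - 1)" and k: "2 \<le> k"
  obtains y r u where "inj_on y {1..k-1}" "independent (y ` {1..k-1})"
    "1 \<le> r" "r \<le> k - 1" "indep_with_one emb r u" "W = T_space emb scale y k r u"
proof -
  obtain B where B: "B \<subseteq> W" "K.independent B" "W \<subseteq> K.span B" "card B = k"
    using W K.basis_exists[of W] by (auto simp: Omega_def)
  have W_span: "W = K.span B"
    using K.span_subspace[OF B(1,3)] W by (simp add: Omega_def)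
  \<comment> \<open>An \<open>L\<close>-basis of the \<open>L\<close>-span of \<open>W\<close>
    chosen inside the \<open>K\<close>-basis \<open>B\<close>. It has one element fewer than
    \<open>B\<close>, and the element left over is \<open>w\<close>.\<close>
  obtain C where C: "C \<subseteq> B" "independent C" "B \<subseteq> span C"
    by (rule maximal_independent_subset)
  have "span C = span B"
    unfolding span_eq using C(3) order_trans[OF C(1) span_superset] by simp
  then have "span C = span W" unfolding W_span span_K_span .
  then have card_C: "card C = k - 1"
    using W dim_span_eq_card_independent[OF C(2)] by (simp add: Omega_def)
  \<comment> \<open>\<open>card\<close> is 0 on infinite sets, so a positive value proves
    finiteness.\<close>
  have "finite B" using B(4) k by (intro card_ge_0_finite) simp
  moreover from this have "finite C" by (rule finite_subset[OF C(1)])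
  ultimately have fin: "finite B" "finite C" .
  then have "card (B - C) = 1" using C(1) B(4) card_C k by (simp add: card_Diff_subset)
  then obtain w where "B - C = {w}" by (auto simp: card_1_singleton_iff)
  then have B_eq: "B = insert w C" and "w \<notin> C" using C(1) by auto
  then have w: "w \<notin> K.span C" "w \<in> span C"
    using B(2) C(3) K.independent_insert[of w C] by auto
  obtain a where a: "w = (\<Sum>c\<in>C. a c *s c)"
    using w(2) span_finite[OF fin(2)] by auto

  have "KL.independent {1}" by (simp add: KL.dependent_single)
  then obtain A where A: "{1} \<subseteq> A" "A \<subseteq> insert 1 (a ` C)" "KL.independent A"
      "insert 1 (a ` C) \<subseteq> KL.span A"
    using KL.maximal_independent_subset_extend[of "{1}" "insert 1 (a ` C)"] by auto
  \<comment> \<open>One index in \<open>C\<close> for each element of \<open>A\<close> other than 1;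
    this makes \<open>a\<close> injective on \<open>J\<close> even if coefficients of
    \<open>w\<close> repeat.\<close>
  define J where "J = inv_into C a ` (A - {1})"
  define r where "r = card J"
  have sub: "A - {1} \<subseteq> a ` C" using A(2) by auto
  have J: "J \<subseteq> C" unfolding J_def using sub by (auto intro: inv_into_into)
  have aJ: "a ` J = A - {1}" and inj_aJ: "inj_on a J"
    unfolding J_def image_image using sub
    by (force simp: f_inv_into_f subset_iff intro!: inj_onI)+
  have finJ: "finite J" using J fin finite_subset by blast
  have r_le: "r \<le> k - 1" unfolding r_def using card_mono[OF fin(2) J] card_C by simp
  obtain p where p: "bij_betw p {1..r} J"
    using finite_same_card_bij[of "{1..r}" J] finJ by (auto simp: r_def)
  obtain p' where p': "bij_betw p' {r+1..k-1} (C - J)"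
    using finite_same_card_bij[of "{r+1..k-1}" "C - J"] fin J finJ card_C
    by (auto simp: r_def card_Diff_subset)
  \<comment> \<open>An enumeration of \<open>C\<close> that lists \<open>J\<close> first, so that
    \<open>u 1, ..., u r\<close> are the chosen coefficients and the later \<open>u j\<close> depend
    on them and on 1 over \<open>K\<close>.\<close>
  define e where "e i = (if i \<in> {1..r} then p i else p' i)" for i
  have eJ: "bij_betw e {1..r} J"
    using p by (rule bij_betw_cong[THEN iffD1, rotated]) (simp add: e_def)
  have "bij_betw e {r+1..k-1} (C - J)"
    using p' by (rule bij_betw_cong[THEN iffD1, rotated]) (simp add: e_def)
  moreover have I: "{1..r} \<union> {r+1..k-1} = {1..k-1}" using r_le by auto
  moreover have "J \<union> (C - J) = C" using J by blast
  ultimately have eC: "bij_betw e {1..k-1} C"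
    using bij_betw_combine[OF eJ, of "{r+1..k-1}" "C - J"] by simp
  define u where "u i = a (e i)" for i
  have u_img: "u ` {1..r} = A - {1}"
    using aJ eJ unfolding u_def bij_betw_def by (metis image_image)
  have inj_u: "inj_on u {1..r}"
    using eJ inj_aJ comp_inj_on[of e "{1..r}" a] by (simp add: u_def[abs_def] bij_betw_def comp_def)
  have indep_u: "indep_with_one emb r u"
    using A inj_u unfolding indep_with_one_def u_img by (simp add: insert_absorb)
  have w_eq: "w = (\<Sum>i=1..k-1. u i *s e i)"
    unfolding a u_def by (rule sum.reindex_bij_betw[OF eC, symmetric])

  have "\<forall>j\<in>{1..k-1}. \<exists>d c. u j = emb d + (\<Sum>i=1..r. emb (c i) * u i)"
  proof
    fix j assume "j \<in> {1..k-1}"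
    then have "e j \<in> C" using eC bij_betwE by blast
    moreover have "insert 1 (u ` {1..r}) = A" using A(1) unfolding u_img by blast
    ultimately have "u j \<in> KL.span (insert 1 (u ` {1..r}))"
      using A(4) by (auto simp: u_def)
    then obtain d c where "u j = restrict_scalars emb (*) d 1
        + (\<Sum>i=1..r. restrict_scalars emb (*) (c i) (u i))"
      by (rule KL.span_insert_familyE[OF finite_atLeastAtMost inj_u])
    then show "\<exists>d c. u j = emb d + (\<Sum>i=1..r. emb (c i) * u i)"
      unfolding KL_scale mult_1_right by blast
  qed
  then obtain d c where uj: "\<And>j. j \<in> {1..k-1} \<Longrightarrow> u j = emb (d j) + (\<Sum>i=1..r. emb (c j i) * u i)"
    by metis
  \<comment> \<open>A shear of the basis \<open>e\<close> that moves the coefficients \<open>u j\<close> with \<open>j > r\<close> into \<open>e 1, \<dots>, e r\<close>.\<close>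
  define y where "y i = (if i \<le> r then e i + (\<Sum>j=r+1..k-1. emb (c j i) *s e j) else e i)" for i
  have split: "(\<Sum>i=1..k-1. f i) = (\<Sum>i=1..r. f i) + (\<Sum>i=r+1..k-1. f i)" for f :: "nat \<Rightarrow> 'v"
    unfolding I[symmetric] by (rule sum.union_disjoint) auto
  have y_sum: "(\<Sum>i=1..r. b i *s y i)
      = (\<Sum>i=1..r. b i *s e i) + (\<Sum>j=r+1..k-1. (\<Sum>i=1..r. emb (c j i) * b i) *s e j)" for b
  proof -
    have "(\<Sum>i=1..r. b i *s y i)
        = (\<Sum>i=1..r. b i *s e i + (\<Sum>j=r+1..k-1. (emb (c j i) * b i) *s e j))"
      by (simp add: y_def scale_right_distrib scale_sum_right mult.commute)
    then show ?thesis
      unfolding sum.distrib scale_sum_left by (subst sum.swap)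
  qed
  have ind_e: "inj_on e {1..k-1}" "independent (e ` {1..k-1})"
    using eC C(2) by (auto simp: bij_betw_def)
  have y_zero: "b i = 0" if eq: "(\<Sum>i=1..k-1. b i *s y i) = 0" and i: "i \<in> {1..k-1}" for b i
  proof -
    \<comment> \<open>The coordinates of the combination with respect to \<open>e\<close>. The
      system is triangular: the first \<open>r\<close> coordinates are those of \<open>b\<close>,
      and once these vanish the others reduce to \<open>b\<close> as well.\<close>
    define b' where "b' j = (if j \<le> r then b j else b j + (\<Sum>i=1..r. emb (c j i) * b i))" for j
    have "(\<Sum>i=1..k-1. b i *s y i) = (\<Sum>i=1..k-1. b' i *s e i)"
      unfolding split y_sum
      by (simp add: b'_def y_def scale_left_distrib sum.distrib)
    then have b': "b' j = 0" if "j \<in> {1..k-1}" for j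
      using independent_familyD[OF _ ind_e, of b' j] eq that by simp
    have low: "b j = 0" if "j \<in> {1..r}" for j
      using b'[of j] that r_le by (auto simp: b'_def)
    show ?thesis
      using b'[OF i] low i by (cases "i \<le> r") (auto simp: b'_def)
  qed
  have ind_y: "inj_on y {1..k-1}" "independent (y ` {1..k-1})"
    using independent_familyI[of "{1..k-1}" y] y_zero by auto

  define w' where "w' = (\<Sum>i=1..r. u i *s y i)"
  \<comment> \<open>Substituting \<open>uj\<close> for \<open>j > r\<close> splits \<open>w\<close>
    into the terms \<open>u i *s y i\<close> and a remainder with coefficients
    \<open>emb (d j)\<close>, which lies in the \<open>K\<close>-span of the
    \<open>e j\<close>.\<close>
  have w'_eq: "w' = w - (\<Sum>j=r+1..k-1. emb (d j) *s e j)"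
  proof -
    have "(\<Sum>i=1..r. emb (c j i) * u i) = u j - emb (d j)" if "j \<in> {r+1..k-1}" for j
      using uj[of j] that by simp
    then show ?thesis
      unfolding w'_def w_eq split y_sum by (simp add: scale_left_diff_distrib sum_subtractf)
  qed
  have K_sum: "(\<Sum>j=r+1..k-1. emb (f j) *s e j) \<in> K.span X" if "e ` {r+1..k-1} \<subseteq> K.span X" for f X
    using that by (auto intro!: K.span_sum K.span_scale simp flip: K_scale)
  have eC': "C = e ` {1..k-1}" using eC by (simp add: bij_betw_def)
  \<comment> \<open>The shear and the passage from \<open>w\<close> to \<open>w'\<close> have
    coefficients in \<open>K\<close> and involve only the \<open>e j\<close> with
    \<open>j > r\<close>, which \<open>y\<close> leaves fixed; hence both can be undone over
    \<open>K\<close>.\<close>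
  have "K.span (insert w C) = K.span (insert w' (y ` {1..k-1}))"
    unfolding K.span_eq
  proof
    let ?X = "K.span (insert w' (y ` {1..k-1}))"
    have e_hi: "e j \<in> ?X" if "j \<in> {r+1..k-1}" for j
      using that by (intro K.span_base) (auto simp: y_def intro!: image_eqI[of _ _ j])
    have e_lo: "e j \<in> ?X" if "j \<in> {1..r}" for j
    proof -
      have "e j = y j - (\<Sum>l=r+1..k-1. emb (c l j) *s e l)" using that by (simp add: y_def)
      also have "\<dots> \<in> ?X"
        using that r_le e_hi by (intro K.span_diff K_sum K.span_base) auto
      finally show ?thesis .
    qed
    have e: "e j \<in> ?X" if "j \<in> {1..k-1}" for j
      using e_hi[of j] e_lo[of j] that by (cases "j \<le> r") auto
    have "w' + (\<Sum>j=r+1..k-1. emb (d j) *s e j) \<in> ?X"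
      using e_hi by (intro K.span_add K_sum K.span_base) auto
    then have "w \<in> ?X" by (simp add: w'_eq)
    then show "insert w C \<subseteq> ?X" using e unfolding eC' by auto
  next
    let ?X = "K.span (insert w C)"
    have e: "e j \<in> ?X" if "j \<in> {1..k-1}" for j
      using that eC' by (intro K.span_base) auto
    then have sum: "(\<Sum>j=r+1..k-1. emb (f j) *s e j) \<in> ?X" for f by (intro K_sum) auto
    have "w' \<in> ?X" unfolding w'_eq by (intro K.span_diff sum K.span_base) simp
    moreover have "y j \<in> ?X" if "j \<in> {1..k-1}" for j
      unfolding y_def using e[OF that] sum by (auto intro: K.span_add)
    ultimately show "insert w' (y ` {1..k-1}) \<subseteq> ?X" by auto
  qed
  then have W_T: "W = T_space emb scale y k r u"
    by (simp add: W_span B_eq T_space_def w'_def)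
  \<comment> \<open>For \<open>r = 0\<close> the sum \<open>w'\<close> is empty, and
    \<open>w\<close> would lie in the \<open>K\<close>-span of \<open>C\<close>, against the
    independence of \<open>B\<close>.\<close>
  have "r \<noteq> 0"
  proof
    assume "r = 0"
    then have "w = (\<Sum>j=r+1..k-1. emb (d j) *s e j)" using w'_eq by (simp add: w'_def)
    also have "\<dots> \<in> K.span C" by (intro K_sum) (auto simp: eC' intro!: K.span_base)
    finally show False using w by simp
  qed
  then show ?thesis using that[OF ind_y _ r_le indep_u W_T] by simp
qed

section \<open>Transport of families by \<open>GL\<close> and the decomposition of
  \<open>Omega\<close>\<close>

lemma is_basis_family_initial:
  assumes "is_basis_family scale m Y" "n \<le> m"
  shows "inj_on Y {1..n}" and "independent (Y ` {1..n})"
proof -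
  have "{1..n} \<subseteq> {1..m}" using assms(2) by auto
  then show "inj_on Y {1..n}" "independent (Y ` {1..n})"
    using assms(1) independent_mono[of "Y ` {1..m}" "Y ` {1..n}"] inj_on_subset[of Y "{1..m}"]
    unfolding is_basis_family_def by blast+
qed

text \<open>The assignment is injective with independent image, so it extends to an injective linear
  map; finite dimension makes this map bijective.\<close>

lemma GL_extends_family:
  assumes Y: "is_basis_family scale m Y" and n: "n \<le> m"
    and y: "inj_on y {1..n}" "independent (y ` {1..n})"
  obtains g where "g \<in> GL scale" "\<And>i. i \<in> {1..n} \<Longrightarrow> g (Y i) = y i"
proof -
  interpret fin: finite_dimensional_vector_space scale "Y ` {1..m}"
    using Y by unfold_locales (auto simp: is_basis_family_def)
  have inj: "inj_on Y {1..n}" and ind: "independent (Y ` {1..n})"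
    using is_basis_family_initial[OF Y n] .
  define f where "f = y \<circ> inv_into {1..n} Y"
  have f: "f (Y i) = y i" if "i \<in> {1..n}" for i
    using that inj by (simp add: f_def)
  have "f ` Y ` {1..n} = y ` {1..n}" using f by (simp add: image_image)
  then have "independent (f ` Y ` {1..n})" using y(2) by simp
  moreover have "inj_on (f \<circ> Y) {1..n}"
    using y(1) f inj_on_cong[of "{1..n}" "f \<circ> Y" y] by simp
  then have "inj_on f (Y ` {1..n})" by (rule inj_on_imageI)
  ultimately obtain g where g: "Vector_Spaces.linear scale scale g" "inj g"
      "\<forall>x\<in>Y ` {1..n}. g x = f x"
    using fin.linear_independent_extend_inj[OF ind, of f] by metis
  then have "bij g" using fin.linear_inj_imp_surj by (simp add: bij_def)
  then show ?thesis using that[of g] g f by (simp add: GL_def)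
qed

lemma T_space_cong:
  assumes "r \<le> k - 1" "\<And>i. i \<in> {1..k-1} \<Longrightarrow> Y i = Y' i"
  shows "T_space emb scale Y k r u = T_space emb scale Y' k r u"
proof -
  have "Y ` {1..k-1} = Y' ` {1..k-1}" using assms(2) by simp
  moreover have "(\<Sum>i=1..r. u i *s Y i) = (\<Sum>i=1..r. u i *s Y' i)"
    using assms by (intro sum.cong) auto
  ultimately show ?thesis by (simp add: T_space_def)
qed

text \<open>The normal form lives on an arbitrary independent family \<open>y\<close>; an element of
  \<open>GL\<close> carrying the fixed \<open>Y i\<close> to the \<open>y i\<close> places it in the
  orbit of a standard space.\<close>

lemma Omega_eq_Union_Omega_r:
  assumes Y: "is_basis_family scale m Y" and k: "2 \<le> k" "k - 1 \<le> m"
  shows "Omega emb scale k (k - 1) = (\<Union>r\<in>{1..k-1}. Omega_r emb scale Y k r)"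
proof (intro subset_antisym subsetI)
  fix W assume "W \<in> Omega emb scale k (k - 1)"
  then obtain y r u where y: "inj_on y {1..k-1}" "independent (y ` {1..k-1})"
    and r: "1 \<le> r" "r \<le> k - 1" and u: "indep_with_one emb r u"
    and W: "W = T_space emb scale y k r u"
    using Omega_imp_T_space k(1) by metis
  obtain g where g: "g \<in> GL scale" "\<And>i. i \<in> {1..k-1} \<Longrightarrow> g (Y i) = y i"
    using GL_extends_family[OF Y k(2) y] by metis
  have "W = g ` T_space emb scale Y k r u"
    unfolding W T_space_image[OF g(1)] using g(2) r by (intro T_space_cong) auto
  then show "W \<in> (\<Union>r\<in>{1..k-1}. Omega_r emb scale Y k r)"
    using g(1) r u unfolding Omega_r_def GL_orbit_def by (intro UN_I[of r] UN_I[of u]) auto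
next
  have "inj_on Y {1..k-1}" "independent (Y ` {1..k-1})"
    using is_basis_family_initial[OF Y] k by auto
  note T = T_space_in_Omega[OF this]
  fix W assume "W \<in> (\<Union>r\<in>{1..k-1}. Omega_r emb scale Y k r)"
  then show "W \<in> Omega emb scale k (k - 1)"
    using T by (auto simp: Omega_r_def GL_orbit_def intro!: Omega_GL_image)
qed

lemma Omega_r_disjoint:
  assumes Y: "is_basis_family scale m Y" and k: "k - 1 \<le> m"
  shows "disjoint_family_on (Omega_r emb scale Y k) {1..k-1}"
proof -
  have Yk: "inj_on Y {1..k-1}" "independent (Y ` {1..k-1})"
    using is_basis_family_initial[OF Y] k by auto
  \<comment> \<open>Stated asymmetrically and used in both directions: spaces in a common orbit map
    onto each other, so each index bounds the other.\<close>
  have le: "r \<le> r'" if r: "r \<in> {1..k-1}" "r' \<in> {1..k-1}"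
    and W: "W \<in> Omega_r emb scale Y k r" "W \<in> Omega_r emb scale Y k r'" for r r' W
  proof -
    obtain u u' where u: "indep_with_one emb r u" "indep_with_one emb r' u'"
      and "W \<in> GL_orbit scale (T_space emb scale Y k r u)"
        "W \<in> GL_orbit scale (T_space emb scale Y k r' u')"
      using W by (auto simp: Omega_r_def)
    then have "T_space emb scale Y k r u \<in> GL_orbit scale (T_space emb scale Y k r' u')"
      using GL_orbit_sym GL_orbit_trans by metis
    then obtain g where "g \<in> GL scale" "g ` T_space emb scale Y k r' u' \<subseteq> T_space emb scale Y k r u"
      by (auto simp: GL_orbit_def)
    then show ?thesis using T_space_image_rank_le[OF Yk _ _ _ u] r by auto
  qed
  show ?thesis
    unfolding disjoint_family_on_def
  proof (intro ballI impI)
    fix r r' assume "r \<in> {1..k-1}" "r' \<in> {1..k-1}" "r \<noteq> r'"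
    then show "Omega_r emb scale Y k r \<inter> Omega_r emb scale Y k r' = {}"
      using le[of r r'] le[of r' r] by fastforce
  qed
qed

lemma Omega_r_GL_closed:
  assumes "W \<in> Omega_r emb scale Y k r" "W' \<in> GL_orbit scale W"
  shows "W' \<in> Omega_r emb scale Y k r"
proof -
  obtain u where "indep_with_one emb r u" "W \<in> GL_orbit scale (T_space emb scale Y k r u)"
    using assms(1) by (auto simp: Omega_r_def)
  moreover from this have "W' \<in> GL_orbit scale (T_space emb scale Y k r u)"
    using assms(2) GL_orbit_trans by metis
  ultimately show ?thesis by (auto simp: Omega_r_def)
qed

end

theorem lemma3p1:
  fixes emb :: "'k::field \<Rightarrow> 'a::field"
    and scale :: "'a \<Rightarrow> 'v::ab_group_add \<Rightarrow> 'v"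
    and Y :: "nat \<Rightarrow> 'v"
    and q m l k :: nat
    and F :: "nat \<Rightarrow> 'v set set"
  assumes "primepow q" and "CARD('k) = q" and "CARD('a) = q ^ l"
    and "field_embedding emb"
    and "vector_space scale"
    and "is_basis_family scale m Y"
    and "3 \<le> k" and "k \<le> min (m + 1) l"
    and "\<And>r. r \<in> {1..k-1} \<Longrightarrow> complete_orbit_reps scale (Omega_r emb scale Y k r) (F r)"
  shows "Omega emb scale k (k - 1) = (\<Union>r\<in>{1..k-1}. Omega_r emb scale Y k r)
    \<and> disjoint_family_on (Omega_r emb scale Y k) {1..k-1}
    \<and> (\<Union>r\<in>{1..k-1}. Omega_r emb scale Y k r) = (\<Union>r\<in>{1..k-1}. \<Union>T\<in>F r. GL_orbit scale T)
    \<and> disjoint_family_on (\<lambda>(r, T). GL_orbit scale T) (SIGMA r:{1..k-1}. F r)"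
proof -
  interpret scalar_extension scale emb
    using assms(4,5) by (simp add: scalar_extension_def scalar_extension_axioms_def)
  let ?O = "Omega_r emb scale Y k"
  have k: "2 \<le> k" "k - 1 \<le> m" using assms(7,8) by auto
  have disj: "disjoint_family_on ?O {1..k-1}"
    by (rule Omega_r_disjoint[OF assms(6) k(2)])
  have O_eq: "?O r = (\<Union>T\<in>F r. GL_orbit scale T)" if "r \<in> {1..k-1}" for r
    by (rule complete_orbit_reps_Union[OF assms(9)[OF that]]) (rule Omega_r_GL_closed)
  \<comment> \<open>Indexing by pairs also separates orbits belonging to different \<open>r\<close>.
    A common member \<open>W\<close> first forces \<open>r = r'\<close> through \<open>disj\<close>,
    and then \<open>T = T'\<close> by uniqueness of representatives.\<close>
  have "disjoint_family_on (\<lambda>(r, T). GL_orbit scale T) (SIGMA r:{1..k-1}. F r)"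
    unfolding disjoint_family_on_def
  proof (clarify, rule ccontr)
    fix r T r' T'
    assume r: "r \<in> {1..k-1}" "r' \<in> {1..k-1}" and T: "T \<in> F r" "T' \<in> F r'"
      and ne: "\<not> (r = r' \<and> T = T')" and "GL_orbit scale T \<inter> GL_orbit scale T' \<noteq> {}"
    then obtain W where W: "W \<in> GL_orbit scale T" "W \<in> GL_orbit scale T'" by auto
    then have "W \<in> ?O r \<inter> ?O r'" using O_eq r T by auto
    then have "r = r'" using disj r unfolding disjoint_family_on_def by blast
    then show False
      using complete_orbit_reps_unique[OF assms(9)[OF r(1)] T(1) _ W] T ne by simp
  qed
  with disj O_eq show ?thesis
    using Omega_eq_Union_Omega_r[OF assms(6) k] by auto
qed

end
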